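(* Let $d\ge 1$ and $m$ be positive integers and let $C=[0,m]^d\subset\mathbb{R}^d$. Then \[ f'_d(m)\le \frac{(m+1)^d-1}{2^d-1}. \] Moreover, equality holds when $m=2^k-1$ for some positive integer $k$.
   Context: A brick of $C$ is a set $[a_1,b_1]\times\cdots\times[a_d,b_d]$ with $a_i,b_i\in\mathbb{Z}$ and $0\le a_i<b_i\le m$. A system of brick islands in $C$ is a set $H$ of bricks of $C$ such that any two members are either nested (one contains the other) or disjoint. A system of cubic islands in $C$ is a system of brick islands in $C$ all of whose members are cubes. Let $I_C$ denote the set of systems of cubic islands in $C$ and $Max(I_C)$ its maximal elements with respect to inclusion. Define $f'_d(m)=\max\{|H|:H\in Max(I_C)\}$. *)

theory Defs
  imports "HOL-Analysis.Analysis"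
begin

text \<open>The dimension \<open>d\<close> is \<open>CARD('d)\<close>, and \<open>C = [0,m]\<^sup>d\<close> is \<open>cbox 0 (\<chi> i. m)\<close>.\<close>

definition bricks :: "nat \<Rightarrow> (real ^ 'd) set set" where
  "bricks m = {cbox a b | a b. \<forall>i. a $ i \<in> \<int> \<and> b $ i \<in> \<int> \<and>
                  0 \<le> a $ i \<and> a $ i < b $ i \<and> b $ i \<le> real m}"

definition is_cube :: "(real ^ 'd) set \<Rightarrow> bool" where
  "is_cube B \<longleftrightarrow> (\<exists>a s. s > 0 \<and> B = cbox a (\<chi> i. a $ i + s))"

text \<open>Bricks are closed, so bricks sharing only boundary points are not disjoint.\<close>

definition brick_island_systems :: "nat \<Rightarrow> (real ^ 'd) set set set" where
  "brick_island_systems m = {H. H \<subseteq> bricks m \<and>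
     (\<forall>A\<in>H. \<forall>B\<in>H. A \<subseteq> B \<or> B \<subseteq> A \<or> A \<inter> B = {})}"

definition cubic_island_systems :: "nat \<Rightarrow> (real ^ 'd) set set set" where
  "cubic_island_systems m = {H \<in> brick_island_systems m. \<forall>B\<in>H. is_cube B}"

definition maximal_elements :: "'a set set \<Rightarrow> 'a set set" where
  "maximal_elements F = {H \<in> F. \<forall>K\<in>F. H \<subseteq> K \<longrightarrow> K = H}"

definition max_cubic_islands :: "'d::finite itself \<Rightarrow> nat \<Rightarrow> nat" where
  "max_cubic_islands _ m =
     Max (card ` maximal_elements (cubic_island_systems m :: (real ^ 'd) set set set))"

text \<open>The following facts show that the cardinalities are those of finite sets and that the
  maximum is taken over a finite nonempty set.\<close>

lemma finite_bricks: "finite (bricks m :: (real ^ 'd) set set)"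
proof -
  let ?S = "real ` {0..m}"
  let ?V = "{v :: real ^ 'd. \<forall>i. v $ i \<in> ?S}"
  have "?V \<subseteq> vec_lambda ` (UNIV \<rightarrow>\<^sub>E ?S)"
  proof
    fix v assume "v \<in> ?V"
    then have "vec_nth v \<in> UNIV \<rightarrow>\<^sub>E ?S" by (auto simp: PiE_def)
    then show "v \<in> vec_lambda ` (UNIV \<rightarrow>\<^sub>E ?S)"
      by (metis imageI vec_nth_inverse)
  qed
  moreover have "finite (vec_lambda ` ((UNIV :: 'd set) \<rightarrow>\<^sub>E ?S))"
    by (intro finite_imageI finite_PiE) auto
  ultimately have fin: "finite ?V" by (rule finite_subset)
  have mem: "x \<in> ?S" if "x \<in> \<int>" "0 \<le> x" "x \<le> real m" for x :: real
  proof -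
    from that obtain z :: int where z: "x = of_int z" by (auto elim: Ints_cases)
    with that have "x = real (nat z)" "nat z \<le> m" by auto
    then show ?thesis by auto
  qed
  have "bricks m \<subseteq> (\<lambda>(a, b). cbox a b) ` (?V \<times> ?V)"
  proof
    fix B :: "(real ^ 'd) set" assume "B \<in> bricks m"
    then obtain a b where B: "B = cbox a b" and ab:
      "\<And>i. a $ i \<in> \<int> \<and> b $ i \<in> \<int> \<and> 0 \<le> a $ i \<and> a $ i < b $ i \<and> b $ i \<le> real m"
      by (auto simp: bricks_def)
    have "a $ i \<in> ?S" "b $ i \<in> ?S" for i
      using ab[of i] by (auto intro!: mem simp del: image_iff)
    then show "B \<in> (\<lambda>(a, b). cbox a b) ` (?V \<times> ?V)"
      unfolding B by (intro image_eqI[where x = "(a, b)"]) auto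
  qed
  then show ?thesis using fin by (meson finite_SigmaI finite_imageI finite_subset)
qed

lemma finite_cubic_island_systems:
  "finite (cubic_island_systems m :: (real ^ 'd) set set set)"
  by (rule finite_subset[OF _ finite_Pow_iff[THEN iffD2, OF finite_bricks[of m]]])
     (auto simp: cubic_island_systems_def brick_island_systems_def)

lemma finite_cubic_island_system:
  "H \<in> cubic_island_systems m \<Longrightarrow> finite (H :: (real ^ 'd) set set)"
  by (rule finite_subset[OF _ finite_bricks[of m]])
     (auto simp: cubic_island_systems_def brick_island_systems_def)

lemma maximal_cubic_island_systems_nonempty:
  "maximal_elements (cubic_island_systems m :: (real ^ 'd) set set set) \<noteq> {}"
proof -
  have "{} \<in> (cubic_island_systems m :: (real ^ 'd) set set set)"
    by (simp add: cubic_island_systems_def brick_island_systems_def)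
  then have "\<exists>H \<in> (cubic_island_systems m :: (real ^ 'd) set set set).
      \<forall>K \<in> cubic_island_systems m. H \<subseteq> K \<longrightarrow> H = K"
    using finite_has_maximal[OF finite_cubic_island_systems] by blast
  then show ?thesis by (fastforce simp: maximal_elements_def)
qed

lemma finite_maximal_cubic_island_systems:
  "finite (maximal_elements (cubic_island_systems m :: (real ^ 'd) set set set))"
  by (rule finite_subset[OF _ finite_cubic_island_systems[of m]])
     (auto simp: maximal_elements_def)

end

theory Submission imports Defs begin

text \<open>Upper bound: a cube with integer corners has \<open>2 ^ d\<close> corners, and a cube properly contained
  in it contains at most one of them. Hence, if \<open>Q\<close> is an island and one lattice point is discarded
  from each maximal island properly inside \<open>Q\<close> (the corner of \<open>Q\<close>, if there is one), what is left of
  these islands is disjoint and avoids all corners of \<open>Q\<close>. By induction, an island with \<open>p\<close> lattice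
  points contains at most \<open>(p - 1) / (2 ^ d - 1)\<close> islands; a maximal system contains the island \<open>C\<close>.

  Equality for \<open>m = 2 ^ k - 1\<close> is attained by the cubes spanned by the dyadic blocks of lattice
  points.\<close>

section \<open>Counting the members of a laminar family\<close>

text \<open>Induction on the number of members properly inside \<open>Q\<close>. In the application
  \<open>P\<close> is the set of lattice points, \<open>K\<close> the corners of \<open>Q\<close>
  and \<open>N + 1 = 2 ^ d\<close>. The maximal members inside \<open>Q\<close> are disjoint and,
  after losing one point each, avoid \<open>K\<close>; so they fit into the
  \<open>card (Q \<inter> P) - (N + 1)\<close> remaining points.\<close>

lemma card_laminar_below:
  fixes H :: "'a set set"
  assumes "finite H" "finite P"
    and laminar: "\<And>A B. A \<in> H \<Longrightarrow> B \<in> H \<Longrightarrow> A \<subseteq> B \<or> B \<subseteq> A \<or> A \<inter> B = {}"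
    and corners: "\<And>Q. Q \<in> H \<Longrightarrow> \<exists>K \<subseteq> Q \<inter> P. card K = N + 1 \<and>
                     (\<forall>R\<in>H. R \<subset> Q \<longrightarrow> card (R \<inter> K) \<le> 1)"
    and "Q \<in> H"
  shows "card {R\<in>H. R \<subseteq> Q} * N + 1 \<le> card (Q \<inter> P)"
  using \<open>Q \<in> H\<close>
proof (induction "card {R\<in>H. R \<subset> Q}" arbitrary: Q rule: less_induct)
  case (less Q)
  obtain K where K: "K \<subseteq> Q \<inter> P" "card K = N + 1"
      and K1: "\<And>R. R \<in> H \<Longrightarrow> R \<subset> Q \<Longrightarrow> card (R \<inter> K) \<le> 1"
    using corners[OF less.prems] by blast
  have finK: "finite K" using K \<open>finite P\<close> finite_subset by blast
  define S where "S = {R\<in>H. R \<subset> Q}"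
  define M where "M = {R\<in>S. \<forall>R'\<in>S. R \<subseteq> R' \<longrightarrow> R' = R}"
  have finS: "finite S" and finM: "finite M" and MS: "M \<subseteq> S"
    using \<open>finite H\<close> by (auto simp: S_def M_def)
  have M_inter: "A \<inter> B = {}" if "A \<in> M" "B \<in> M" "A \<noteq> B" for A B
  proof -
    have "A \<in> H" "B \<in> H" using that by (auto simp: M_def S_def)
    with laminar[of A B] that show ?thesis by (auto simp: M_def)
  qed
  have IH: "card {R\<in>H. R \<subseteq> A} * N \<le> card (A \<inter> P) - 1" "1 \<le> card (A \<inter> P)" if "A \<in> M" for A
  proof -
    have "A \<in> H" "A \<subset> Q" using that by (auto simp: M_def S_def)
    then have "{R\<in>H. R \<subset> A} \<subset> {R\<in>H. R \<subset> Q}" by blast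
    then have "card {R\<in>H. R \<subset> A} < card {R\<in>H. R \<subset> Q}"
      using \<open>finite H\<close> by (intro psubset_card_mono) auto
    from less.hyps[OF this \<open>A \<in> H\<close>]
    show "card {R\<in>H. R \<subseteq> A} * N \<le> card (A \<inter> P) - 1" "1 \<le> card (A \<inter> P)" by auto
  qed
  \<comment> \<open>The point to discard is the one in \<open>A \<inter> K\<close> if it exists,
    otherwise any point of \<open>A \<inter> P\<close>. Lying in \<open>P\<close>, it lowers the
    count of \<open>A\<close> by exactly one, which is the \<open>+ 1\<close> in the induction
    hypothesis.\<close>
  have "\<exists>p. p \<in> A \<inter> P \<and> A \<inter> K \<subseteq> {p}" if "A \<in> M" for A
  proof (cases "A \<inter> K = {}")
    case True
    have "A \<inter> P \<noteq> {}" using IH(2)[OF that] by auto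
    with True show ?thesis by auto
  next
    case False
    have "card (A \<inter> K) \<le> 1" using K1 that by (auto simp: M_def S_def)
    moreover have "card (A \<inter> K) \<noteq> 0" using False finK by simp
    ultimately have "card (A \<inter> K) = 1" by simp
    then obtain p where "A \<inter> K = {p}" by (auto simp: card_1_singleton_iff)
    then show ?thesis using K(1) by (intro exI[of _ p]) auto
  qed
  then obtain p where p: "\<And>A. A \<in> M \<Longrightarrow> p A \<in> A \<inter> P" "\<And>A. A \<in> M \<Longrightarrow> A \<inter> K \<subseteq> {p A}"
    by metis
  have S_sub: "S \<subseteq> (\<Union>A\<in>M. {R\<in>H. R \<subseteq> A})"
  proof
    fix R assume "R \<in> S"
    then obtain A where A: "A \<in> S" "R \<subseteq> A" "\<forall>R'\<in>S. A \<subseteq> R' \<longrightarrow> A = R'"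
      using finite_has_maximal2[OF finS] by blast
    then have "A \<in> M" by (auto simp: M_def)
    with A \<open>R \<in> S\<close> show "R \<in> (\<Union>A\<in>M. {R\<in>H. R \<subseteq> A})" by (auto simp: S_def)
  qed
  have "card S \<le> card (\<Union>A\<in>M. {R\<in>H. R \<subseteq> A})"
    using S_sub finM \<open>finite H\<close> by (intro card_mono) auto
  also have "\<dots> \<le> (\<Sum>A\<in>M. card {R\<in>H. R \<subseteq> A})"
    using finM by (rule card_UN_le)
  finally have "card S * N \<le> (\<Sum>A\<in>M. card {R\<in>H. R \<subseteq> A}) * N" by simp
  also have "\<dots> \<le> (\<Sum>A\<in>M. card (A \<inter> P) - 1)"
    unfolding sum_distrib_right by (intro sum_mono IH)
  also have "\<dots> = (\<Sum>A\<in>M. card (A \<inter> P - {p A}))"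
    using p \<open>finite P\<close> by (intro sum.cong refl) (auto simp: card_Diff_singleton)
  also have "\<dots> = card (\<Union>A\<in>M. A \<inter> P - {p A})"
    using finM \<open>finite P\<close> M_inter by (intro card_UN_disjoint[symmetric]) blast+
  also have "\<dots> \<le> card (Q \<inter> P - K)"
    using p \<open>finite P\<close> MS by (intro card_mono) (auto simp: S_def)
  also have "\<dots> = card (Q \<inter> P) - (N + 1)"
    using K finK by (simp add: card_Diff_subset)
  finally have "card S * N \<le> card (Q \<inter> P) - (N + 1)" .
  \<comment> \<open>This rules out truncation in the subtraction of \<open>N + 1\<close>
    above.\<close>
  moreover have "N + 1 \<le> card (Q \<inter> P)"
    using K \<open>finite P\<close> card_mono[of "Q \<inter> P" K] by simp
  \<comment> \<open>Counting \<open>Q\<close> itself costs another \<open>N\<close>; with the final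
    \<open>+ 1\<close> this uses up exactly the \<open>N + 1\<close> points of
    \<open>K\<close>.\<close>
  moreover have "card {R\<in>H. R \<subseteq> Q} = Suc (card S)"
  proof -
    have "{R\<in>H. R \<subseteq> Q} = insert Q S" using less.prems by (auto simp: S_def)
    then show ?thesis using finS by (simp add: S_def)
  qed
  ultimately show ?case by simp
qed

section \<open>Lattice points and corners of cubic bricks\<close>

text \<open>Serves three counts: lattice points, corners of a cube, and dyadic indices of a given
  depth.\<close>

lemma card_vec_nth_mem:
  fixes S :: "'d::finite \<Rightarrow> 'a set"
  shows "card {v :: 'a ^ 'd. \<forall>i. v $ i \<in> S i} = (\<Prod>i\<in>UNIV. card (S i))"
proof -
  have "bij_betw vec_nth {v :: 'a ^ 'd. \<forall>i. v $ i \<in> S i} (PiE UNIV S)"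
    by (rule bij_betwI[where g = vec_lambda]) (auto simp: PiE_def)
  then have "card {v :: 'a ^ 'd. \<forall>i. v $ i \<in> S i} = card (PiE UNIV S)"
    by (rule bij_betw_same_card)
  then show ?thesis by (simp add: card_PiE)
qed

definition lattice_points :: "nat \<Rightarrow> (real ^ 'd) set" where
  "lattice_points m = {v. \<forall>i. v $ i \<in> real ` {0..m}}"

lemma card_lattice_points: "card (lattice_points m :: (real ^ 'd::finite) set) = (m + 1) ^ CARD('d)"
  unfolding lattice_points_def by (subst card_vec_nth_mem) (simp add: card_image)

lemma finite_lattice_points: "finite (lattice_points m :: (real ^ 'd::finite) set)"
  by (rule card_ge_0_finite) (simp add: card_lattice_points)

lemma Ints_mem_image_real:
  assumes "x \<in> \<int>" "0 \<le> x" "x \<le> real m"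
  shows "x \<in> real ` {0..m}"
proof -
  obtain z :: int where "x = of_int z" using assms(1) by (auto elim: Ints_cases)
  with assms have "x = real (nat z)" "nat z \<le> m" by auto
  then show ?thesis by auto
qed

text \<open>A nonempty box determines its extreme corners, so the integer corners of the brick agree
  with the base point and side length of the cube.\<close>

lemma cubic_brickE:
  fixes B :: "(real ^ 'd::finite) set"
  assumes "B \<in> bricks m" "is_cube B"
  obtains a s where "B = cbox a (\<chi> i. a $ i + s)" "s > 0"
    "\<And>i. a $ i \<in> real ` {0..m}" "\<And>i. a $ i + s \<in> real ` {0..m}"
proof -
  obtain a b where B: "B = cbox a b" and ab:
      "\<And>i. a $ i \<in> \<int> \<and> b $ i \<in> \<int> \<and> 0 \<le> a $ i \<and> a $ i < b $ i \<and> b $ i \<le> real m"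
    using assms(1) by (auto simp: bricks_def)
  obtain a' s where s: "s > 0" "B = cbox a' (\<chi> i. a' $ i + s)"
    using assms(2) by (auto simp: is_cube_def)
  have "a \<in> cbox a b" using ab by (simp add: mem_box_cart less_imp_le)
  then have "cbox a b \<noteq> {}" by blast
  then have "a = a' \<and> b = (\<chi> i. a' $ i + s)"
    using eq_cbox[of a b a' "\<chi> i. a' $ i + s"] B s by auto
  then have a: "a = a'" and b: "\<And>i. b $ i = a' $ i + s" by auto
  have "a $ i \<in> real ` {0..m}" "b $ i \<in> real ` {0..m}" for i
    using ab[of i] by (auto intro!: Ints_mem_image_real simp del: image_iff)
  then show thesis using that[of a' s] s a b by simp
qed

text \<open>Two distinct corners of the outer cube differ by \<open>s\<close> in some coordinate, so
  the inner cube has side at least \<open>s\<close>. Having equal sides, it is then as long as the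
  outer cube in every direction, and inclusion leaves no room to shift it.\<close>

lemma subcube_eq_if_two_corners:
  fixes a a' :: "real ^ 'd::finite"
  assumes sub: "cbox a' (\<chi> i. a' $ i + s') \<subseteq> cbox a (\<chi> i. a $ i + s)"
    and "0 < s" "0 < s'"
    and x: "x \<in> cbox a' (\<chi> i. a' $ i + s')" "\<And>i. x $ i \<in> {a $ i, a $ i + s}"
    and y: "y \<in> cbox a' (\<chi> i. a' $ i + s')" "\<And>i. y $ i \<in> {a $ i, a $ i + s}"
    and "x \<noteq> y"
  shows "cbox a' (\<chi> i. a' $ i + s') = cbox a (\<chi> i. a $ i + s)"
proof -
  obtain i where "x $ i \<noteq> y $ i" using \<open>x \<noteq> y\<close> by (auto simp: vec_eq_iff)
  with x(2)[of i] y(2)[of i] have "\<bar>x $ i - y $ i\<bar> = s" using \<open>0 < s\<close> by auto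
  moreover have "a' $ i \<le> x $ i" "x $ i \<le> a' $ i + s'" "a' $ i \<le> y $ i" "y $ i \<le> a' $ i + s'"
    using x(1) y(1) by (auto simp: mem_box_cart)
  ultimately have "s \<le> s'" by linarith
  have "a' \<in> cbox a' (\<chi> i. a' $ i + s')" "(\<chi> i. a' $ i + s') \<in> cbox a' (\<chi> i. a' $ i + s')"
    using \<open>0 < s'\<close> by (auto simp: mem_box_cart)
  with sub have "a' \<in> cbox a (\<chi> i. a $ i + s)" "(\<chi> i. a' $ i + s') \<in> cbox a (\<chi> i. a $ i + s)"
    by blast+
  \<comment> \<open>These inequalities give \<open>s' \<le> s\<close>; together with
    \<open>s \<le> s'\<close> they become equalities.\<close>
  then have "a $ j \<le> a' $ j" "a' $ j + s' \<le> a $ j + s" for j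
    by (auto simp: mem_box_cart)
  then have "a' $ j = a $ j \<and> s' = s" for j
    using \<open>s \<le> s'\<close> by (smt (verit))
  then have "a' = a" "s' = s" by (auto simp: vec_eq_iff)
  then show ?thesis by simp
qed

text \<open>Provides the assumption \<open>corners\<close> of \<open>card_laminar_below\<close>:
  \<open>K\<close> consists of all corners of \<open>Q\<close>, and a smaller cube containing two of
  them would equal \<open>Q\<close>.\<close>

lemma cubic_brick_corners:
  fixes Q :: "(real ^ 'd::finite) set"
  assumes "Q \<in> bricks m" "is_cube Q"
  shows "\<exists>K \<subseteq> Q \<inter> lattice_points m. card K = 2 ^ CARD('d) \<and>
           (\<forall>R \<in> bricks m. is_cube R \<longrightarrow> R \<subset> Q \<longrightarrow> card (R \<inter> K) \<le> 1)"
proof -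
  obtain a s where Q: "Q = cbox a (\<chi> i. a $ i + s)" "s > 0"
      and a: "\<And>i. a $ i \<in> real ` {0..m}" "\<And>i. a $ i + s \<in> real ` {0..m}"
    using cubic_brickE[OF assms] by blast
  define K where "K = {v :: real ^ 'd. \<forall>i. v $ i \<in> {a $ i, a $ i + s}}"
  have "card K = (\<Prod>i\<in>(UNIV :: 'd set). card {a $ i, a $ i + s})"
    unfolding K_def by (rule card_vec_nth_mem)
  then have card: "card K = 2 ^ CARD('d)" using \<open>s > 0\<close> by (simp add: numeral_2_eq_2)
  have "K \<subseteq> Q \<inter> lattice_points m"
  proof
    fix v assume "v \<in> K"
    then have v: "v $ i = a $ i \<or> v $ i = a $ i + s" for i by (auto simp: K_def)
    have "a $ i \<le> v $ i \<and> v $ i \<le> a $ i + s" for i using v[of i] \<open>s > 0\<close> by auto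
    then have "v \<in> Q" by (simp add: Q mem_box_cart)
    moreover have "v $ i \<in> real ` {0..m}" for i using v[of i] a[of i] by metis
    then have "v \<in> lattice_points m" by (simp add: lattice_points_def)
    ultimately show "v \<in> Q \<inter> lattice_points m" by simp
  qed
  moreover have "card (R \<inter> K) \<le> 1" if R: "R \<in> bricks m" "is_cube R" "R \<subset> Q" for R
  proof -
    obtain a' s' where R': "R = cbox a' (\<chi> i. a' $ i + s')" "s' > 0"
      using R(2) by (auto simp: is_cube_def)
    have "x = y" if "x \<in> R \<inter> K" "y \<in> R \<inter> K" for x y
    proof (rule ccontr)
      assume "x \<noteq> y"
      then have "R = Q"
        unfolding R' Q using that R(3) Q R'
        by (intro subcube_eq_if_two_corners[where x = x and y = y]) (auto simp: K_def)
      then show False using R(3) by simp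
    qed
    moreover have "finite (R \<inter> K)" using card card_ge_0_finite[of K] by simp
    ultimately show ?thesis by (auto simp: card_le_Suc0_iff_eq)
  qed
  ultimately show ?thesis using card by blast
qed

section \<open>Upper bound for maximal systems\<close>

lemma brick_subset_whole_cube:
  fixes B :: "(real ^ 'd::finite) set"
  assumes "B \<in> bricks m"
  shows "B \<subseteq> cbox 0 (\<chi> i. real m)"
proof -
  obtain a b where B: "B = cbox a b" and ab: "\<And>i. 0 \<le> a $ i" "\<And>i. b $ i \<le> real m"
    using assms by (auto simp: bricks_def)
  show ?thesis
    unfolding B subset_iff mem_box_cart using order_trans[OF ab(1)] order_trans[OF _ ab(2)]
    by (simp, blast)
qed

text \<open>Every brick is nested in \<open>C\<close>, so adding \<open>C\<close> to a system gives
  a system again, and maximality forces \<open>C\<close> to be there already. The assumption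
  \<open>m \<ge> 1\<close> makes \<open>C\<close> a brick of positive side.\<close>

lemma whole_cube_in_maximal:
  fixes H :: "(real ^ 'd::finite) set set"
  assumes "m \<ge> 1" "H \<in> maximal_elements (cubic_island_systems m)"
  shows "cbox 0 (\<chi> i. real m) \<in> H"
proof -
  let ?C = "cbox 0 (\<chi> i. real m) :: (real ^ 'd) set"
  have H: "H \<in> cubic_island_systems m" and
    max: "\<And>K. K \<in> cubic_island_systems m \<Longrightarrow> H \<subseteq> K \<Longrightarrow> K = H"
    using assms(2) by (auto simp: maximal_elements_def)
  have "?C \<in> bricks m"
    using \<open>m \<ge> 1\<close> unfolding bricks_def mem_Collect_eq
    by (intro exI[of _ 0] exI[of _ "\<chi> i. real m"]) simp
  moreover have "is_cube ?C"
    using \<open>m \<ge> 1\<close> unfolding is_cube_def by (intro exI[of _ 0] exI[of _ "real m"]) simp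
  ultimately have "insert ?C H \<in> cubic_island_systems m"
    using H brick_subset_whole_cube[where m = m and 'd = 'd]
    by (auto simp: cubic_island_systems_def brick_island_systems_def)
  then show ?thesis using max[of "insert ?C H"] by blast
qed

text \<open>The laminar bound is applied at \<open>Q = C\<close>, which lies above all members and
  contains all \<open>(m + 1) ^ d\<close> lattice points.\<close>

lemma card_maximal_cubic_island_system_le:
  fixes H :: "(real ^ 'd::finite) set set"
  assumes "m \<ge> 1" "H \<in> maximal_elements (cubic_island_systems m)"
  shows "card H * (2 ^ CARD('d) - 1) + 1 \<le> (m + 1) ^ CARD('d)"
proof -
  let ?C = "cbox 0 (\<chi> i. real m) :: (real ^ 'd) set"
  have H: "H \<in> cubic_island_systems m"
    using assms(2) by (auto simp: maximal_elements_def)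
  then have cubes: "Q \<in> bricks m" "is_cube Q" if "Q \<in> H" for Q
    using that by (auto simp: cubic_island_systems_def brick_island_systems_def)
  have "card {R\<in>H. R \<subseteq> ?C} * (2 ^ CARD('d) - 1) + 1 \<le> card (?C \<inter> lattice_points m)"
  proof (rule card_laminar_below)
    show "finite H" using H by (rule finite_cubic_island_system)
    show "finite (lattice_points m :: (real ^ 'd) set)" by (rule finite_lattice_points)
    show "A \<subseteq> B \<or> B \<subseteq> A \<or> A \<inter> B = {}" if "A \<in> H" "B \<in> H" for A B
      using H that by (auto simp: cubic_island_systems_def brick_island_systems_def)
    show "?C \<in> H" using assms by (rule whole_cube_in_maximal)
    show "\<exists>K \<subseteq> Q \<inter> lattice_points m. card K = 2 ^ CARD('d) - 1 + 1 \<and>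
            (\<forall>R\<in>H. R \<subset> Q \<longrightarrow> card (R \<inter> K) \<le> 1)" if "Q \<in> H" for Q
    proof -
      obtain K where "K \<subseteq> Q \<inter> lattice_points m" "card K = 2 ^ CARD('d)"
          "\<And>R. R \<in> bricks m \<Longrightarrow> is_cube R \<Longrightarrow> R \<subset> Q \<Longrightarrow> card (R \<inter> K) \<le> 1"
        using cubic_brick_corners[OF cubes[OF \<open>Q \<in> H\<close>]] by blast
      then show ?thesis using cubes by (intro exI[of _ K]) simp
    qed
  qed
  moreover have "{R\<in>H. R \<subseteq> ?C} = H"
    using cubes(1) brick_subset_whole_cube by blast
  moreover have "?C \<inter> lattice_points m = lattice_points m"
  proof -
    have "0 \<le> x \<and> x \<le> real m" if "x \<in> real ` {0..m}" for x using that by auto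
    then have "lattice_points m \<subseteq> ?C" by (auto simp: lattice_points_def mem_box_cart)
    then show ?thesis by blast
  qed
  ultimately show ?thesis by (simp add: card_lattice_points)
qed

section \<open>Dyadic cubes and their island system\<close>

text \<open>A block of \<open>2 ^ j\<close> lattice points along each axis spans a side of only
  \<open>2 ^ j - 1\<close>. The unit gap between neighbouring blocks keeps these closed cubes
  disjoint.\<close>

definition dyadic_cube :: "nat \<Rightarrow> nat ^ 'd \<Rightarrow> (real ^ 'd) set" where
  "dyadic_cube j c = cbox (\<chi> i. real (2 ^ j * c $ i)) (\<chi> i. real (2 ^ j * c $ i) + (2 ^ j - 1))"

lemma mem_dyadic_cube:
  "x \<in> dyadic_cube j c \<longleftrightarrow>
     (\<forall>i. 2 ^ j * real (c $ i) \<le> x $ i \<and> x $ i \<le> 2 ^ j * (real (c $ i) + 1) - 1)"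
  by (simp add: dyadic_cube_def mem_box_cart algebra_simps)

text \<open>With \<open>n = l - j\<close>, block \<open>e\<close> of level \<open>l\<close> consists
  of the level-\<open>j\<close> blocks with indices from \<open>2 ^ n * e\<close> up to, but
  excluding, \<open>2 ^ n * (e + 1)\<close>, coordinatewise. Either \<open>c\<close> is in this
  range in every coordinate, or some coordinate separates the cubes.\<close>

lemma dyadic_cube_laminar:
  fixes c e :: "nat ^ 'd::finite"
  assumes "j \<le> l"
  shows "dyadic_cube j c \<subseteq> dyadic_cube l e \<or> dyadic_cube j c \<inter> dyadic_cube l e = {}"
proof -
  define n where "n = l - j"
  have pow: "(2::real) ^ l = 2 ^ j * 2 ^ n"
    using assms by (simp add: n_def flip: power_add)
  have scale: "2 ^ j * u \<le> 2 ^ l * v" if "u \<le> 2 ^ n * v" for u v :: real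
    using that by (simp add: pow mult.assoc)
  have scale': "2 ^ l * v \<le> 2 ^ j * u" if "2 ^ n * v \<le> u" for u v :: real
    using that by (simp add: pow mult.assoc)
  show ?thesis
  proof (cases "\<forall>i. 2 ^ n * e $ i \<le> c $ i \<and> c $ i + 1 \<le> 2 ^ n * (e $ i + 1)")
    case True
    have "2 ^ l * real (e $ i) \<le> 2 ^ j * real (c $ i)"
        "2 ^ j * (real (c $ i) + 1) \<le> 2 ^ l * (real (e $ i) + 1)" for i
    proof -
      have "real (2 ^ n * e $ i) \<le> real (c $ i)" "real (c $ i + 1) \<le> real (2 ^ n * (e $ i + 1))"
        using True of_nat_mono by blast+
      then show "2 ^ l * real (e $ i) \<le> 2 ^ j * real (c $ i)"
        "2 ^ j * (real (c $ i) + 1) \<le> 2 ^ l * (real (e $ i) + 1)"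
        by - (rule scale', simp, rule scale, simp add: algebra_simps)
    qed
    then have "dyadic_cube j c \<subseteq> dyadic_cube l e"
      unfolding subset_iff mem_dyadic_cube by (smt (verit))
    then show ?thesis ..
  next
    case False
    then obtain i where "\<not> (2 ^ n * e $ i \<le> c $ i \<and> c $ i + 1 \<le> 2 ^ n * (e $ i + 1))" by blast
    \<comment> \<open>Integrality excludes a partial overlap: \<open>c < x\<close> means
      \<open>c + 1 \<le> x\<close>.\<close>
    then have "c $ i + 1 \<le> 2 ^ n * e $ i \<or> 2 ^ n * (e $ i + 1) \<le> c $ i" by linarith
    then have "real (c $ i + 1) \<le> real (2 ^ n * e $ i) \<or> real (2 ^ n * (e $ i + 1)) \<le> real (c $ i)"
      using of_nat_mono by blast
    then have "2 ^ j * (real (c $ i) + 1) \<le> 2 ^ l * real (e $ i) \<or>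
        2 ^ l * (real (e $ i) + 1) \<le> 2 ^ j * real (c $ i)"
      using scale[of "real (c $ i) + 1" "real (e $ i)"]
        scale'[of "real (e $ i) + 1" "real (c $ i)"] by (auto simp: algebra_simps)
    then have "dyadic_cube j c \<inter> dyadic_cube l e = {}"
      unfolding disjoint_iff mem_dyadic_cube by (smt (verit))
    then show ?thesis ..
  qed
qed

lemma dyadic_cube_inject:
  fixes c e :: "nat ^ 'd::finite"
  assumes "dyadic_cube j c = dyadic_cube l e"
  shows "j = l \<and> c = e"
proof -
  have "dyadic_cube j c \<noteq> {}"
    by (auto simp: dyadic_cube_def interval_eq_empty_cart not_less)
  then have "(\<chi> i. real (2 ^ j * c $ i)) = (\<chi> i. real (2 ^ l * e $ i)) \<and>
      (\<chi> i. real (2 ^ j * c $ i) + (2 ^ j - 1)) = (\<chi> i. real (2 ^ l * e $ i) + (2 ^ l - 1))"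
    using assms unfolding dyadic_cube_def eq_cbox by metis
  then have eq: "real (2 ^ j * c $ i) = real (2 ^ l * e $ i)"
      "real (2 ^ j * c $ i) + (2 ^ j - 1) = real (2 ^ l * e $ i) + (2 ^ l - 1)" for i
    unfolding vec_eq_iff vec_lambda_beta by blast+
  \<comment> \<open>Any coordinate will do, and \<open>undefined\<close> names one; subtracting the
    lower end from the upper end compares the side lengths.\<close>
  from eq[of undefined] have "(2::real) ^ j = 2 ^ l" by simp
  then have "j = l" by simp
  with eq(1) show ?thesis by (simp add: vec_eq_iff)
qed

text \<open>Here \<open>t\<close> is the depth: \<open>2 ^ t\<close> blocks per axis, each of
  \<open>2 ^ (k - t)\<close> lattice points. Stopping at \<open>t < k\<close> leaves out the
  single-point blocks, which are not bricks.\<close>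

definition dyadic_index :: "nat \<Rightarrow> (nat \<times> (nat ^ 'd)) set" where
  "dyadic_index k = (SIGMA t:{..<k}. {c. \<forall>i. c $ i \<in> {..<2 ^ t}})"

definition dyadic_system :: "nat \<Rightarrow> (real ^ 'd) set set" where
  "dyadic_system k = (\<lambda>(t, c). dyadic_cube (k - t) c) ` dyadic_index k"

text \<open>Distinct indices give distinct cubes, and depth \<open>t\<close> contributes
  \<open>(2 ^ t) ^ d\<close> of them.\<close>

lemma card_dyadic_system:
  "card (dyadic_system k :: (real ^ 'd::finite) set set) = (\<Sum>t<k. (2 ^ CARD('d)) ^ t)"
proof -
  have "inj_on (\<lambda>(t, c). dyadic_cube (k - t) c) (dyadic_index k :: (nat \<times> (nat ^ 'd)) set)"
    by (auto simp: inj_on_def dyadic_index_def dest!: dyadic_cube_inject)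
  then have "card (dyadic_system k :: (real ^ 'd) set set) =
      card (dyadic_index k :: (nat \<times> (nat ^ 'd)) set)"
    unfolding dyadic_system_def by (rule card_image)
  also have "\<dots> = (\<Sum>t<k. card {c :: nat ^ 'd. \<forall>i. c $ i \<in> {..<2 ^ t}})"
  proof -
    have "finite {c :: nat ^ 'd. \<forall>i. c $ i \<in> {..<2 ^ t}}" for t :: nat
      by (rule card_ge_0_finite) (simp only: card_vec_nth_mem, simp)
    then show ?thesis unfolding dyadic_index_def by (intro card_SigmaI) auto
  qed
  also have "\<dots> = (\<Sum>t<k. (2 ^ CARD('d)) ^ t)"
    by (simp only: card_vec_nth_mem) (simp add: mult.commute flip: power_mult)
  finally show ?thesis .
qed

lemma dyadic_system_cubic:
  "(dyadic_system k :: (real ^ 'd::finite) set set) \<in> cubic_island_systems (2 ^ k - 1)"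
proof -
  have brick: "B \<in> bricks (2 ^ k - 1) \<and> is_cube B" if B: "B \<in> dyadic_system k"
    for B :: "(real ^ 'd) set"
  proof -
    obtain t c where t: "t < k" and c: "\<And>i. c $ i < 2 ^ t" and B: "B = dyadic_cube (k - t) c"
      using B by (auto simp: dyadic_system_def dyadic_index_def)
    define s :: real where "s = 2 ^ (k - t) - 1"
    define a :: "real ^ 'd" where "a = (\<chi> i. real (2 ^ (k - t) * c $ i))"
    have Ba: "B = cbox a (\<chi> i. a $ i + s)" by (simp add: B dyadic_cube_def a_def s_def)
    have "s > 0" using t one_less_power[of "2::real" "k - t"] by (simp add: s_def)
    \<comment> \<open>The last block at each depth ends at \<open>2 ^ k - 1\<close>, since
      \<open>2 ^ t\<close> blocks of \<open>2 ^ (k - t)\<close> points make \<open>2 ^ k\<close>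
      points.\<close>
    have upper: "a $ i + s \<le> real (2 ^ k - 1)" for i
    proof -
      have "2 ^ (k - t) * (c $ i + 1) \<le> 2 ^ (k - t) * 2 ^ t"
        using c[of i] by (intro mult_left_mono) auto
      also have "\<dots> = (2::nat) ^ k" using t by (simp flip: power_add)
      finally have "real (2 ^ (k - t) * (c $ i + 1)) \<le> real (2 ^ k)" by (rule of_nat_mono)
      then show ?thesis by (simp add: a_def s_def algebra_simps)
    qed
    have "s \<in> \<int>" "\<And>i. a $ i \<in> \<int>" "\<And>i. 0 \<le> a $ i" by (simp_all add: s_def a_def)
    then have "B \<in> bricks (2 ^ k - 1)"
      unfolding bricks_def mem_Collect_eq using Ba upper \<open>s > 0\<close>
      by (intro exI[of _ a] exI[of _ "\<chi> i. a $ i + s"]) simp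
    then show ?thesis using Ba \<open>s > 0\<close> by (auto simp: is_cube_def)
  qed
  have "A \<subseteq> B \<or> B \<subseteq> A \<or> A \<inter> B = {}" if AB: "A \<in> dyadic_system k" "B \<in> dyadic_system k"
    for A B :: "(real ^ 'd) set"
  proof -
    obtain j c l e where "A = dyadic_cube j c" "B = dyadic_cube l e"
      using AB by (auto simp: dyadic_system_def)
    then show ?thesis
      using dyadic_cube_laminar[of j l c e] dyadic_cube_laminar[of l j e c] nat_le_linear[of j l]
      by blast
  qed
  with brick show ?thesis by (auto simp: cubic_island_systems_def brick_island_systems_def)
qed

theorem theorem3:
  fixes m :: nat
  assumes "m \<ge> 1"
  shows "real (max_cubic_islands TYPE('d::finite) m)
           \<le> ((real m + 1) ^ CARD('d) - 1) / (2 ^ CARD('d) - 1) \<and>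
         ((\<exists>k::nat. k \<ge> 1 \<and> m = 2 ^ k - 1) \<longrightarrow>
           real (max_cubic_islands TYPE('d) m)
             = ((real m + 1) ^ CARD('d) - 1) / (2 ^ CARD('d) - 1))"
proof -
  let ?M = "maximal_elements (cubic_island_systems m :: (real ^ 'd) set set set)"
  define N :: real where "N = 2 ^ CARD('d) - 1"
  have "N > 0" using one_less_power[of "2::real" "CARD('d)"] by (simp add: N_def)
  have fin: "finite (card ` ?M)" by (simp add: finite_maximal_cubic_island_systems)
  have "max_cubic_islands TYPE('d) m \<in> card ` ?M"
    unfolding max_cubic_islands_def using fin maximal_cubic_island_systems_nonempty
    by (intro Max_in) auto
  then obtain H where H: "H \<in> ?M" "max_cubic_islands TYPE('d) m = card H" by auto
  have "real (card H * (2 ^ CARD('d) - 1) + 1) \<le> real ((m + 1) ^ CARD('d))"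
    using card_maximal_cubic_island_system_le[OF assms H(1)] by (rule of_nat_mono)
  then have "real (card H) * N \<le> (real m + 1) ^ CARD('d) - 1"
    by (simp add: N_def add.commute)
  then have upper: "real (max_cubic_islands TYPE('d) m) \<le> ((real m + 1) ^ CARD('d) - 1) / N"
    using \<open>N > 0\<close> H by (simp add: field_simps)
  have "((real m + 1) ^ CARD('d) - 1) / N \<le> real (max_cubic_islands TYPE('d) m)"
    if m: "m = 2 ^ k - 1" for k
  proof -
    let ?D = "dyadic_system k :: (real ^ 'd) set set"
    have "?D \<in> cubic_island_systems m" using m dyadic_system_cubic by simp
    \<comment> \<open>Maximality of the dyadic system need not be checked: some maximal system
      contains it and is at least as large.\<close>
    then obtain K where K: "K \<in> cubic_island_systems m" "?D \<subseteq> K"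
        "\<forall>K'\<in>cubic_island_systems m. K \<subseteq> K' \<longrightarrow> K = K'"
      using finite_has_maximal2[OF finite_cubic_island_systems] by blast
    then have "K \<in> ?M" by (auto simp: maximal_elements_def)
    then have "card K \<le> max_cubic_islands TYPE('d) m"
      unfolding max_cubic_islands_def using fin by (intro Max_ge) auto
    moreover have "card ?D \<le> card K"
      using K finite_cubic_island_system by (intro card_mono) auto
    moreover have "real (card ?D) = ((real m + 1) ^ CARD('d) - 1) / N"
    proof -
      have "real m + 1 = 2 ^ k" using m by simp
      then have "(real m + 1) ^ CARD('d) = (2 ^ CARD('d)) ^ k"
        by (simp add: mult.commute flip: power_mult)
      \<comment> \<open>The ratio of the geometric sum differs from 1, so its closed form applies,
        with \<open>(2 ^ d) ^ k = (m + 1) ^ d\<close>.\<close>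
      moreover have "(2 ^ CARD('d) :: real) \<noteq> 1" using \<open>N > 0\<close> unfolding N_def by linarith
      ultimately show ?thesis
        using geometric_sum[of "2 ^ CARD('d) :: real" k] by (simp add: card_dyadic_system N_def)
    qed
    ultimately show ?thesis by linarith
  qed
  with upper show ?thesis unfolding N_def by (blast intro: order_antisym)
qed

end
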